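(* Let $\mathcal{A}\subset\mathbb{P}^n$ be any (finite) hyperplane arrangement, defined by $f_{\mathcal{A}}$. Then the initial degree of $\mathrm{Jac}(f_{\mathcal{A}})^{top}$ is $$a(\mathrm{Jac}(f_{\mathcal{A}})^{top})=|\mathcal{A}|-1.$$ Moreover, $\mathrm{Jac}(f_{\mathcal{A}})^{top}$ has at least as many minimal generators of degree $|\mathcal{A}|-1$ as $\mathrm{Jac}(f_{\mathcal{A}})$.
   Context: $K$ is a field of characteristic zero, $n\ge2$, $S=K[x_0,\dots,x_n]$ with the standard grading. A hyperplane arrangement $\mathcal{A}\subset\mathbb{P}^n$ is a finite nonempty set of distinct hyperplanes, and $f_{\mathcal{A}}$ is the product of linear forms defining them. $\mathrm{Jac}(f_{\mathcal{A}})\subset S$ is the ideal generated by the first partial derivatives of $f_{\mathcal{A}}$. $\mathrm{Jac}(f_{\mathcal{A}})^{top}$ is the intersection of the primary components of height $2$ in a primary decomposition of $\mathrm{Jac}(f_{\mathcal{A}})$ (this is well defined). The initial degree of a graded module $M$ is $a(M)=\inf\{j\in\mathbb{Z}: [M]_j\neq0\}$. *)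

theory Defs
  imports
    "HOL-Library.Poly_Mapping"
    "HOL-Library.Extended_Nat"
    "HOL-Analysis.Finite_Cartesian_Product"
begin

section \<open>Ideals of a commutative ring\<close>

text \<open>A commutative ring is a module over itself: its ideals are the submodules
  \<open>ring_self.subspace\<close>, and \<open>ring_self.span G\<close> is the ideal generated by \<open>G\<close>.\<close>

interpretation ring_self: module "(*) :: 'a::comm_ring_1 \<Rightarrow> 'a \<Rightarrow> 'a"
  by unfold_locales (simp_all add: algebra_simps)

definition prime_ideal :: "'a::comm_ring_1 set \<Rightarrow> bool" where
  "prime_ideal P \<longleftrightarrow> ring_self.subspace P \<and> P \<noteq> UNIV \<and>
     (\<forall>a b. a * b \<in> P \<longrightarrow> a \<in> P \<or> b \<in> P)"

definition primary_ideal :: "'a::comm_ring_1 set \<Rightarrow> bool" where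
  "primary_ideal Q \<longleftrightarrow> ring_self.subspace Q \<and> Q \<noteq> UNIV \<and>
     (\<forall>a b. a * b \<in> Q \<longrightarrow> a \<in> Q \<or> (\<exists>k. b ^ k \<in> Q))"

definition prime_height :: "'a::comm_ring_1 set \<Rightarrow> enat" where
  "prime_height P = Sup {enat k | k. \<exists>C :: nat \<Rightarrow> 'a set.
     (\<forall>i\<le>k. prime_ideal (C i)) \<and> (\<forall>i<k. C i \<subset> C (Suc i)) \<and> C k = P}"

definition ideal_height :: "'a::comm_ring_1 set \<Rightarrow> enat" where
  "ideal_height I = Inf {prime_height P | P. prime_ideal P \<and> I \<subseteq> P}"

text \<open>Irredundancy is not required. The decomposition of the unit ideal is the empty one.\<close>

definition primary_decomposition :: "'a::comm_ring_1 set set \<Rightarrow> 'a set \<Rightarrow> bool" where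
  "primary_decomposition D I \<longleftrightarrow> finite D \<and> (\<forall>Q\<in>D. primary_ideal Q) \<and> \<Inter>D = I"

definition height_two_part :: "'a::comm_ring_1 set set \<Rightarrow> 'a set" where
  "height_two_part D = \<Inter>{Q \<in> D. ideal_height Q = 2}"


section \<open>The standard graded polynomial ring\<close>

text \<open>The variables are indexed by a finite type \<open>'v\<close>, so that the polynomial ring in
  \<open>n + 1\<close> variables is obtained for \<open>CARD('v) = n + 1\<close>.\<close>

type_synonym ('v, 'k) mpoly = "('v \<Rightarrow>\<^sub>0 nat) \<Rightarrow>\<^sub>0 'k"

definition graded_piece :: "nat \<Rightarrow> ('v::finite, 'k::comm_ring_1) mpoly set" where
  "graded_piece d = {p. \<forall>m \<in> Poly_Mapping.keys p. (\<Sum>i\<in>UNIV. Poly_Mapping.lookup m i) = d}"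

definition partial_deriv ::
    "'v::finite \<Rightarrow> ('v, 'k::comm_ring_1) mpoly \<Rightarrow> ('v, 'k) mpoly" where
  "partial_deriv i p = (\<Sum>m \<in> Poly_Mapping.keys p.
     Poly_Mapping.single (m - Poly_Mapping.single i 1)
       (of_nat (Poly_Mapping.lookup m i) * Poly_Mapping.lookup p m))"

definition Jac :: "('v::finite, 'k::comm_ring_1) mpoly \<Rightarrow> ('v, 'k) mpoly set" where
  "Jac f = ring_self.span (range (\<lambda>i. partial_deriv i f))"

text \<open>For a homogeneous ideal \<open>I\<close>, the degree \<open>j\<close> component is \<open>I \<inter> graded_piece j\<close>.
  The zero ideal has initial degree \<open>\<infinity>\<close>.\<close>

definition initial_degree :: "('v::finite, 'k::comm_ring_1) mpoly set \<Rightarrow> enat" where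
  "initial_degree I = Inf {enat j | j. I \<inter> graded_piece j \<noteq> {0}}"

definition minimal_generators ::
    "('v::finite, 'k::comm_ring_1) mpoly set \<Rightarrow> ('v, 'k) mpoly set \<Rightarrow> bool" where
  "minimal_generators G I \<longleftrightarrow> G \<subseteq> (\<Union>d. graded_piece d) \<and> ring_self.span G = I \<and>
     (\<forall>G'. G' \<subset> G \<longrightarrow> ring_self.span G' \<noteq> I)"


section \<open>Hyperplane arrangements\<close>

definition linear_form :: "'k::comm_ring_1 ^ 'v::finite \<Rightarrow> ('v, 'k) mpoly" where
  "linear_form a = (\<Sum>i\<in>UNIV. Poly_Mapping.single (Poly_Mapping.single i 1) (a $ i))"

text \<open>A hyperplane of projective space is represented by its cone, a linear hyperplane of
  the space of homogeneous coordinate vectors.\<close>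

definition hyperplane_of :: "'k::field ^ 'v::finite \<Rightarrow> ('k ^ 'v) set" where
  "hyperplane_of a = {x. (\<Sum>i\<in>UNIV. a $ i * x $ i) = 0}"

definition hyperplane_arrangement :: "('k::field ^ 'v::finite) set set \<Rightarrow> bool" where
  "hyperplane_arrangement A \<longleftrightarrow> finite A \<and> A \<noteq> {} \<and>
     (\<forall>H\<in>A. \<exists>a. a \<noteq> 0 \<and> H = hyperplane_of a)"

text \<open>The linear forms are determined only up to nonzero scalars, hence a relation:
  \<open>f\<close> is the product of some choice of linear forms defining the hyperplanes in \<open>A\<close>.\<close>

definition defining_polynomial ::
    "('k::field ^ 'v::finite) set set \<Rightarrow> ('v, 'k) mpoly \<Rightarrow> bool" where
  "defining_polynomial A f \<longleftrightarrow>
     (\<exists>a. (\<forall>H\<in>A. a H \<noteq> 0 \<and> H = hyperplane_of (a H)) \<and> f = (\<Prod>H\<in>A. linear_form (a H)))"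

end

theory Submission
  imports Defs "HOL-Computational_Algebra.Factorial_Ring"
begin

text \<open>Let \<open>g\<close> be a form in the height two part, of degree less than \<open>card A - 1\<close>, and let
  \<open>H\<close> be a hyperplane in \<open>A\<close>. Modulo the linear form of \<open>H\<close>, every partial derivative of
  \<open>f\<close> is a scalar multiple of the product \<open>F\<close> of the other \<open>card A - 1\<close> linear forms. Localizing
  at the codimension two flats \<open>H \<inter> H'\<close> shows that \<open>F\<close> divides \<open>g\<close> modulo the form of \<open>H\<close>, so
  this form divides \<open>g\<close> by comparing degrees. As \<open>H\<close> is arbitrary, \<open>f\<close> divides \<open>g\<close>, whence
  \<open>g = 0\<close>. Below degree \<open>card A - 1\<close> the height two part is therefore zero, so in that degree the minimal
  generators of either ideal are linearly independent and those of the height two part span a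
  space that contains those of the Jacobian ideal.\<close>

section \<open>Polynomials and substitution\<close>

alias lookup = Poly_Mapping.lookup
alias keys = Poly_Mapping.keys
alias single = Poly_Mapping.single

abbreviation pconst :: "'k::zero \<Rightarrow> ('v \<Rightarrow>\<^sub>0 nat) \<Rightarrow>\<^sub>0 'k" where
  "pconst c \<equiv> single 0 c"

definition pvar :: "'v \<Rightarrow> ('v, 'k::comm_ring_1) mpoly" where
  "pvar i = single (single i 1) 1"

lemma poly_mapping_single_add_induct [case_names single add]:
  fixes p :: "'a \<Rightarrow>\<^sub>0 'b::monoid_add"
  assumes "\<And>m c. P (single m c)" and "\<And>p q. P p \<Longrightarrow> P q \<Longrightarrow> P (p + q)"
  shows "P p"
proof (induction p rule: update_induct)
  case const
  show ?case using assms(1)[of undefined 0] by simp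
next
  case (update f a b)
  have "Poly_Mapping.update a b f = f + single a b"
    using update(1)
    by (intro poly_mapping_eqI) (auto simp: lookup_update lookup_add lookup_single when_def in_keys_iff)
  then show ?case using update(3) assms by simp
qed

text \<open>Constants and variables generate the polynomial ring. This rule reduces statements about
  ring homomorphisms, such as substitutions, to these generators.\<close>

lemma mpoly_ring_induct [case_names const var add mult]:
  fixes p :: "('v, 'k::comm_ring_1) mpoly"
  assumes const: "\<And>c. P (pconst c)" and var: "\<And>i. P (pvar i)"
    and add: "\<And>p q. P p \<Longrightarrow> P q \<Longrightarrow> P (p + q)"
    and mult: "\<And>p q. P p \<Longrightarrow> P q \<Longrightarrow> P (p * q)"
  shows "P p"
proof (induction p rule: poly_mapping_single_add_induct)
  case (single m c)
  \<comment> \<open>Exponent vectors are finitely supported maps too, so the preceding induction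
    rule also splits \<open>m\<close> into multiples of single variables.\<close>
  have "P (single m 1)"
  proof (induction m rule: poly_mapping_single_add_induct)
    case (single i k)
    show ?case
    proof (induction k)
      case 0
      show ?case using const[of 1] by simp
    next
      case (Suc k)
      have "single (single i (Suc k)) (1::'k) = pvar i * single (single i k) 1"
        by (simp add: pvar_def mult_single flip: single_add)
      then show ?case using Suc var mult by metis
    qed
  next
    case (add m m')
    have "single (m + m') (1::'k) = single m 1 * single m' 1"
      by (simp add: mult_single)
    then show ?case using add mult by metis
  qed
  then have "P (pconst c * single m 1)" using const mult by blast
  then show ?case by (simp add: mult_single)
qed (rule add)

definition monomial_value :: "('v \<Rightarrow> 'r::comm_ring_1) \<Rightarrow> ('v \<Rightarrow>\<^sub>0 nat) \<Rightarrow> 'r" where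
  "monomial_value \<sigma> m = (\<Prod>i\<in>keys m. \<sigma> i ^ lookup m i)"

lemma monomial_value_superset:
  assumes "finite S" "keys m \<subseteq> S"
  shows "monomial_value \<sigma> m = (\<Prod>i\<in>S. \<sigma> i ^ lookup m i)"
  unfolding monomial_value_def
  by (rule prod.mono_neutral_left) (use assms in \<open>auto simp: in_keys_iff\<close>)

lemma monomial_value_0 [simp]: "monomial_value \<sigma> 0 = 1"
  by (simp add: monomial_value_def)

lemma monomial_value_add: "monomial_value \<sigma> (m + m') = monomial_value \<sigma> m * monomial_value \<sigma> m'"
proof -
  let ?S = "keys m \<union> keys m'"
  have "monomial_value \<sigma> (m + m') = (\<Prod>i\<in>?S. \<sigma> i ^ lookup (m + m') i)"
    using keys_add[of m m'] by (intro monomial_value_superset) auto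
  also have "\<dots> = (\<Prod>i\<in>?S. \<sigma> i ^ lookup m i) * (\<Prod>i\<in>?S. \<sigma> i ^ lookup m' i)"
    by (simp add: lookup_add power_add prod.distrib)
  also have "(\<Prod>i\<in>?S. \<sigma> i ^ lookup m i) = monomial_value \<sigma> m"
    by (rule monomial_value_superset[symmetric]) auto
  also have "(\<Prod>i\<in>?S. \<sigma> i ^ lookup m' i) = monomial_value \<sigma> m'"
    by (rule monomial_value_superset[symmetric]) auto
  finally show ?thesis .
qed

text \<open>The ring homomorphism that fixes constants and sends \<open>pvar i\<close> to
  \<open>\<sigma> i\<close>. Source and target may have different variables; the renaming in
  \<open>mpoly_mult_eq_0_iff\<close> relies on this.\<close>

definition psubst :: "('v \<Rightarrow> ('w, 'k::comm_ring_1) mpoly) \<Rightarrow> ('v, 'k) mpoly \<Rightarrow> ('w, 'k) mpoly" where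
  "psubst \<sigma> p = (\<Sum>m\<in>keys p. pconst (lookup p m) * monomial_value \<sigma> m)"

lemma psubst_add: "psubst \<sigma> (p + q) = psubst \<sigma> p + psubst \<sigma> q"
  unfolding psubst_def
  by (rule setsum_keys_plus_distrib[where f = "\<lambda>m c. pconst c * monomial_value \<sigma> m"])
    (simp_all add: single_add algebra_simps)

lemma psubst_single: "psubst \<sigma> (single m c) = pconst c * monomial_value \<sigma> m"
  by (simp add: psubst_def)

lemma psubst_pconst [simp]: "psubst \<sigma> (pconst c) = pconst c"
  by (simp add: psubst_single)

lemma psubst_0 [simp]: "psubst \<sigma> 0 = 0"
  by (simp add: psubst_def)

lemma psubst_1 [simp]: "psubst \<sigma> 1 = 1"
  using psubst_pconst[of \<sigma> 1] by simp

lemma psubst_pvar [simp]: "psubst \<sigma> (pvar i) = \<sigma> i"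
  by (simp add: pvar_def psubst_single monomial_value_def)

lemma psubst_mult: "psubst \<sigma> (p * q) = psubst \<sigma> p * psubst \<sigma> q"
proof (induction p rule: poly_mapping_single_add_induct)
  case (single m c)
  show ?case
  proof (induction q rule: poly_mapping_single_add_induct)
    case (single m' c')
    have "psubst \<sigma> (single m c * single m' c')
        = (pconst c * pconst c') * (monomial_value \<sigma> m * monomial_value \<sigma> m')"
      by (simp add: mult_single psubst_single monomial_value_add)
    then show ?case unfolding psubst_single by (simp only: mult_ac)
  qed (simp add: distrib_left psubst_add)
qed (simp add: distrib_right psubst_add)

lemma psubst_sum: "psubst \<sigma> (\<Sum>x\<in>X. h x) = (\<Sum>x\<in>X. psubst \<sigma> (h x))"
  by (induction X rule: infinite_finite_induct) (simp_all add: psubst_add)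

lemma psubst_prod: "psubst \<sigma> (\<Prod>x\<in>X. h x) = (\<Prod>x\<in>X. psubst \<sigma> (h x))"
  by (induction X rule: infinite_finite_induct) (simp_all add: psubst_mult)

lemma psubst_id: "psubst pvar p = p"
  by (induction p rule: mpoly_ring_induct) (simp_all add: psubst_add psubst_mult)

lemma psubst_cong:
  assumes "\<And>m i. m \<in> keys p \<Longrightarrow> i \<in> keys m \<Longrightarrow> \<sigma> i = \<tau> i"
  shows "psubst \<sigma> p = psubst \<tau> p"
  unfolding psubst_def monomial_value_def
  by (intro sum.cong prod.cong arg_cong2[of _ _ _ _ "(*)"] refl) (simp add: assms)

text \<open>The library instance of \<open>idom\<close> needs linearly ordered exponents, so the variables
  are renamed to natural numbers.\<close>

lemma mpoly_mult_eq_0_iff: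
  fixes p q :: "('v::finite, 'k::idom) mpoly"
  shows "p * q = 0 \<longleftrightarrow> p = 0 \<or> q = 0"
proof
  obtain e :: "'v \<Rightarrow> nat" where e: "inj e"
    using finite_imp_inj_to_nat_seg[of "UNIV :: 'v set"] by auto
  define \<phi> :: "('v, 'k) mpoly \<Rightarrow> (nat, 'k) mpoly" where "\<phi> = psubst (\<lambda>i. pvar (e i))"
  \<comment> \<open>The renaming is injective because substitution along an inverse of
    \<open>e\<close> undoes it.\<close>
  have left_inv: "psubst (\<lambda>j. pvar (inv e j)) (\<phi> h) = h" for h
    unfolding \<phi>_def using e
    by (induction h rule: mpoly_ring_induct) (simp_all add: psubst_add psubst_mult)
  have zero: "h = 0" if "\<phi> h = 0" for h
    using left_inv[of h] that by simp
  assume "p * q = 0"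
  then have "\<phi> p * \<phi> q = 0"
    by (simp add: \<phi>_def flip: psubst_mult)
  then show "p = 0 \<or> q = 0" using zero by (auto simp: mult_eq_0_iff)
qed auto

lemma mpoly_mult_left_cancel:
  fixes p q r :: "('v::finite, 'k::idom) mpoly"
  assumes "p \<noteq> 0" "p * q = p * r"
  shows "q = r"
proof -
  have "p * (q - r) = 0" using assms(2) by (simp add: right_diff_distrib)
  then show ?thesis using assms(1) by (simp add: mpoly_mult_eq_0_iff)
qed

section \<open>Total degree and homogeneous polynomials\<close>

definition monomial_degree :: "('v::finite \<Rightarrow>\<^sub>0 nat) \<Rightarrow> nat" where
  "monomial_degree m = (\<Sum>i\<in>UNIV. lookup m i)"

lemma monomial_degree_add: "monomial_degree (m + m') = monomial_degree m + monomial_degree m'"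
  by (simp add: monomial_degree_def lookup_add sum.distrib)

lemma monomial_degree_single [simp]: "monomial_degree (single i k) = k"
  by (simp add: monomial_degree_def lookup_single when_def)

lemma monomial_degree_0 [simp]: "monomial_degree 0 = 0"
  by (simp add: monomial_degree_def)

lemma monomial_degree_eq_0_iff [simp]: "monomial_degree m = 0 \<longleftrightarrow> m = 0"
  by (auto simp: monomial_degree_def intro!: poly_mapping_eqI)

lemma graded_piece_iff: "p \<in> graded_piece d \<longleftrightarrow> (\<forall>m\<in>keys p. monomial_degree m = d)"
  by (simp add: graded_piece_def monomial_degree_def)

lemma graded_piece_0 [simp]: "0 \<in> graded_piece d"
  by (simp add: graded_piece_iff)

lemma graded_piece_add: "p \<in> graded_piece d \<Longrightarrow> q \<in> graded_piece d \<Longrightarrow> p + q \<in> graded_piece d"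
  using keys_add[of p q] by (auto simp: graded_piece_iff)

lemma graded_piece_diff: "p \<in> graded_piece d \<Longrightarrow> q \<in> graded_piece d \<Longrightarrow> p - q \<in> graded_piece d"
proof -
  assume *: "p \<in> graded_piece d" "q \<in> graded_piece d"
  have "keys (p - q) \<subseteq> keys p \<union> keys q" by (auto simp: in_keys_iff lookup_minus)
  then show ?thesis using * by (auto simp: graded_piece_iff)
qed

lemma graded_piece_sum: "(\<And>x. x \<in> X \<Longrightarrow> h x \<in> graded_piece d) \<Longrightarrow> (\<Sum>x\<in>X. h x) \<in> graded_piece d"
  by (induction X rule: infinite_finite_induct) (auto intro: graded_piece_add)

lemma graded_piece_mult: "p \<in> graded_piece a \<Longrightarrow> q \<in> graded_piece b \<Longrightarrow> p * q \<in> graded_piece (a + b)"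
  using keys_mult[of p q] by (fastforce simp: graded_piece_iff monomial_degree_add)

lemma graded_piece_single: "monomial_degree m = d \<Longrightarrow> single m c \<in> graded_piece d"
  by (simp add: graded_piece_iff)

lemma graded_piece_pconst [simp]: "pconst c \<in> graded_piece 0"
  by (simp add: graded_piece_single)

lemma graded_piece_1: "1 \<in> graded_piece 0"
  by (simp add: graded_piece_iff)

lemma graded_piece_pvar: "pvar i \<in> graded_piece 1"
  unfolding pvar_def by (rule graded_piece_single) simp

lemma graded_piece_prod:
  "(\<And>x. x \<in> X \<Longrightarrow> h x \<in> graded_piece (d x)) \<Longrightarrow> (\<Prod>x\<in>X. h x) \<in> graded_piece (\<Sum>x\<in>X. d x)"
  by (induction X rule: infinite_finite_induct) (auto intro: graded_piece_mult graded_piece_1)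

lemma graded_piece_power: "p \<in> graded_piece d \<Longrightarrow> p ^ k \<in> graded_piece (k * d)"
  by (induction k) (auto intro: graded_piece_mult graded_piece_1)

lemma psubst_graded_piece:
  assumes \<sigma>: "\<And>i. \<sigma> i \<in> graded_piece 1" and p: "p \<in> graded_piece d"
  shows "psubst \<sigma> p \<in> graded_piece d"
  unfolding psubst_def
proof (rule graded_piece_sum)
  fix m assume m: "m \<in> keys p"
  have "monomial_value \<sigma> m = (\<Prod>i\<in>UNIV. \<sigma> i ^ lookup m i)"
    by (rule monomial_value_superset) auto
  also have "\<dots> \<in> graded_piece (\<Sum>i\<in>UNIV. lookup m i * 1)"
    by (intro graded_piece_prod graded_piece_power \<sigma>)
  finally have "monomial_value \<sigma> m \<in> graded_piece d"
    using m p by (simp add: graded_piece_iff monomial_degree_def)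
  then show "pconst (lookup p m) * monomial_value \<sigma> m \<in> graded_piece d"
    using graded_piece_mult[OF graded_piece_pconst] by fastforce
qed

text \<open>The \<open>d\<close>-th power of the ideal generated by all variables. It serves to
  compute modulo terms of higher degree.\<close>

definition order_ge :: "nat \<Rightarrow> ('v::finite, 'k::comm_ring_1) mpoly set" where
  "order_ge d = {p. \<forall>m\<in>keys p. d \<le> monomial_degree m}"

lemma order_ge_mult: "p \<in> order_ge a \<Longrightarrow> q \<in> order_ge b \<Longrightarrow> p * q \<in> order_ge (a + b)"
  using keys_mult[of p q] by (fastforce simp: order_ge_def monomial_degree_add)

lemma order_ge_add: "p \<in> order_ge a \<Longrightarrow> q \<in> order_ge a \<Longrightarrow> p + q \<in> order_ge a"
  using keys_add[of p q] by (auto simp: order_ge_def)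

lemma order_ge_0: "p \<in> order_ge 0"
  by (simp add: order_ge_def)

lemma order_ge_zero [simp]: "0 \<in> order_ge d"
  by (simp add: order_ge_def)

lemma graded_piece_order_ge: "p \<in> graded_piece d \<Longrightarrow> d' \<le> d \<Longrightarrow> p \<in> order_ge d'"
  by (auto simp: graded_piece_iff order_ge_def)

lemma graded_piece_order_ge_eq_0:
  assumes "p \<in> graded_piece e" "p \<in> order_ge d" "e < d"
  shows "p = 0"
proof -
  have "keys p = {}" using assms by (fastforce simp: graded_piece_iff order_ge_def)
  then show ?thesis by simp
qed

text \<open>Whatever the quotient, homogeneous or not, every term of a multiple of \<open>q\<close>
  has degree at least \<open>d\<close>.\<close>

lemma homogeneous_dvd_low_degree_eq_0:
  assumes "q \<in> graded_piece d" "p \<in> graded_piece e" "e < d" "q dvd p"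
  shows "p = 0"
proof -
  obtain c where "p = q * c" using assms(4) by (rule dvdE)
  then have "p \<in> order_ge (d + 0)"
    using order_ge_mult[OF graded_piece_order_ge[OF assms(1)] order_ge_0] by auto
  then show ?thesis using graded_piece_order_ge_eq_0 assms by auto
qed


section \<open>Linear forms\<close>

lemma linear_form_altdef: "linear_form a = (\<Sum>i\<in>UNIV. pconst (a $ i) * pvar i)"
  by (simp add: linear_form_def pvar_def mult_single)

lemma linear_form_diff_scale:
  fixes a b :: "'k::comm_ring_1 ^ 'v::finite"
  shows "linear_form (b - c *s a) = linear_form b - pconst c * linear_form a"
proof -
  have "pconst (b $ i - c * a $ i) = pconst (b $ i) - pconst c * (pconst (a $ i) :: ('v, 'k) mpoly)" for i
    by (simp add: single_diff mult_single)
  then have "pconst ((b - c *s a) $ i) * pvar i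
      = pconst (b $ i) * pvar i - pconst c * (pconst (a $ i) * pvar i)" for i
    by (simp only: vector_minus_component vector_smult_component left_diff_distrib mult.assoc)
  then show ?thesis
    unfolding linear_form_altdef by (simp only: sum_subtractf sum_distrib_left)
qed

lemma lookup_linear_form: "lookup (linear_form a) (single i 1) = a $ i"
proof -
  have "lookup (linear_form a) (single i 1) = (\<Sum>j\<in>UNIV. if j = i then a $ j else 0)"
    unfolding linear_form_def lookup_sum
  proof (rule sum.cong[OF refl])
    fix j
    have "single j (1::nat) = single i 1 \<longleftrightarrow> j = i"
      by (metis lookup_single_eq lookup_single_not_eq zero_neq_one)
    then have "single j (Suc 0) = single i (Suc 0) \<longleftrightarrow> j = i" by simp
    then show "lookup (single (single j (1::nat)) (a $ j)) (single i 1) = (if j = i then a $ j else 0)"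
      by (auto simp: lookup_single when_def)
  qed
  then show ?thesis by simp
qed

lemma linear_form_eq_0_iff [simp]: "linear_form a = 0 \<longleftrightarrow> a = 0"
proof
  assume "linear_form a = 0"
  then show "a = 0" by (metis lookup_linear_form lookup_zero vec_eq_iff zero_index)
qed (simp add: linear_form_def)

lemma linear_form_graded_piece: "linear_form a \<in> graded_piece 1"
  unfolding linear_form_def by (intro graded_piece_sum graded_piece_single) simp

text \<open>Solving the equation \<open>linear_form a = 0\<close> for the variable \<open>u\<close>.\<close>

definition eliminate :: "'k::field ^ 'v::finite \<Rightarrow> 'v \<Rightarrow> ('v, 'k) mpoly \<Rightarrow> ('v, 'k) mpoly" where
  "eliminate a u = psubst (\<lambda>i. if i = u then pvar u - pconst (1 / a $ u) * linear_form a else pvar i)"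

text \<open>On coefficient vectors elimination is the projection along \<open>a\<close> that kills
  coordinate \<open>u\<close>. If \<open>a $ u\<close> is zero, both quotients are zero by
  convention and nothing is substituted.\<close>

lemma eliminate_linear_form:
  fixes a :: "'k::field ^ 'v::finite"
  shows "eliminate a u (linear_form b) = linear_form (b - (b $ u / a $ u) *s a)"
proof -
  have *: "eliminate a u (linear_form b) = (\<Sum>i\<in>UNIV. pconst (b $ i) * 
      (if i = u then pvar u - pconst (1 / a $ u) * linear_form a else pvar i))"
    by (simp add: linear_form_altdef[of b] eliminate_def psubst_sum psubst_mult)
  have "\<dots> = (\<Sum>i\<in>UNIV. pconst (b $ i) * pvar i - 
      (if i = u then pconst (b $ u) * pconst (1 / a $ u) * linear_form a else 0))"
    by (rule sum.cong) (simp_all only: right_diff_distrib mult.assoc if_True if_False split: if_split, auto)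
  also have "\<dots> = linear_form b - pconst (b $ u) * pconst (1 / a $ u) * linear_form a"
    by (simp add: linear_form_altdef[of b] sum_subtractf)
  finally show ?thesis
    by (simp add: * linear_form_diff_scale mult_single)
qed

lemma eliminate_mult: "eliminate a u (p * q) = eliminate a u p * eliminate a u q"
  by (simp add: eliminate_def psubst_mult)

lemma eliminate_add: "eliminate a u (p + q) = eliminate a u p + eliminate a u q"
  by (simp add: eliminate_def psubst_add)

lemma eliminate_0 [simp]: "eliminate a u 0 = 0"
  by (simp add: eliminate_def)

lemma eliminate_1 [simp]: "eliminate a u 1 = 1"
  by (simp add: eliminate_def)

lemma eliminate_pconst [simp]: "eliminate a u (pconst c) = pconst c"
  by (simp add: eliminate_def)

lemma eliminate_prod: "eliminate a u (\<Prod>x\<in>X. h x) = (\<Prod>x\<in>X. eliminate a u (h x))"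
  by (simp add: eliminate_def psubst_prod)

lemma eliminate_graded_piece:
  assumes "p \<in> graded_piece d"
  shows "eliminate a u p \<in> graded_piece d"
proof -
  have "pconst (1 / a $ u) * linear_form a \<in> graded_piece (0 + 1)"
    by (intro graded_piece_mult graded_piece_pconst linear_form_graded_piece)
  then have "pvar u - pconst (1 / a $ u) * linear_form a \<in> graded_piece 1"
    by (intro graded_piece_diff graded_piece_pvar) simp
  then show ?thesis
    unfolding eliminate_def using assms graded_piece_pvar
    by (intro psubst_graded_piece) auto
qed

lemma eliminate_ident:
  assumes "\<And>m. m \<in> keys p \<Longrightarrow> lookup m u = 0"
  shows "eliminate a u p = p"
proof -
  have "eliminate a u p = psubst pvar p"
    unfolding eliminate_def by (rule psubst_cong) (metis assms in_keys_iff)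
  then show ?thesis by (simp add: psubst_id)
qed

text \<open>Elimination moves \<open>pvar u\<close> by a multiple of the form and fixes the other
  variables; congruence modulo the form then passes to sums and products.\<close>

lemma linear_form_dvd_diff_eliminate: "linear_form a dvd p - eliminate a u p"
proof (induction p rule: mpoly_ring_induct)
  case (add p q)
  then have "linear_form a dvd (p - eliminate a u p) + (q - eliminate a u q)" by (rule dvd_add)
  then show ?case by (simp add: eliminate_add algebra_simps)
next
  case (mult p q)
  then have "linear_form a dvd (p - eliminate a u p) * q + eliminate a u p * (q - eliminate a u q)"
    by (intro dvd_add) auto
  then show ?case by (simp add: eliminate_mult algebra_simps)
next
  case (var i)
  have "pvar u - eliminate a u (pvar u) = linear_form a * pconst (1 / a $ u)"
    by (simp add: eliminate_def)
  moreover have "pvar i - eliminate a u (pvar i) = 0" if "i \<noteq> u"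
    using that by (simp add: eliminate_def)
  ultimately show ?case by (cases "i = u") simp_all
qed simp

text \<open>The kernel of elimination is the principal ideal of the form. Thus
  \<open>eliminate a u\<close> models the quotient ring inside the polynomial ring itself.\<close>

lemma eliminate_eq_0_iff:
  assumes "a $ u \<noteq> 0"
  shows "eliminate a u p = 0 \<longleftrightarrow> linear_form a dvd p"
proof
  assume "eliminate a u p = 0"
  then show "linear_form a dvd p" using linear_form_dvd_diff_eliminate[of a p u] by simp
next
  assume "linear_form a dvd p"
  moreover have "eliminate a u (linear_form a) = 0"
    using assms by (simp add: eliminate_linear_form)
  ultimately show "eliminate a u p = 0" by (auto simp: eliminate_mult)
qed

text \<open>Elimination maps into a domain, and the kernel of such a homomorphism is prime.\<close>

lemma prime_elem_linear_form:
  fixes a :: "'k::field ^ 'v::finite"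
  assumes "a \<noteq> 0"
  shows "prime_elem (linear_form a)"
proof -
  obtain u where u: "a $ u \<noteq> 0" using assms by (auto simp: vec_eq_iff)
  note dvd_iff = eliminate_eq_0_iff[OF u, symmetric]
  show ?thesis
  proof (rule prime_elemI)
    show "linear_form a \<noteq> 0" using assms by simp
    show "\<not> linear_form a dvd 1" by (simp add: dvd_iff)
    fix p q assume "linear_form a dvd p * q"
    then have "eliminate a u p * eliminate a u q = 0"
      unfolding dvd_iff eliminate_mult .
    then show "linear_form a dvd p \<or> linear_form a dvd q"
      unfolding dvd_iff mpoly_mult_eq_0_iff .
  qed
qed

lemma linear_form_dvd_imp_proportional:
  fixes a b :: "'k::field ^ 'v::finite"
  assumes "a \<noteq> 0" "linear_form a dvd linear_form b"
  shows "\<exists>c. b = c *s a"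
proof -
  obtain u where u: "a $ u \<noteq> 0" using assms by (auto simp: vec_eq_iff)
  have "b - (b $ u / a $ u) *s a = 0"
    using assms(2) unfolding eliminate_eq_0_iff[OF u, symmetric] eliminate_linear_form by simp
  then show ?thesis by auto
qed

lemma hyperplane_of_scale:
  assumes "c \<noteq> 0"
  shows "hyperplane_of (c *s a) = hyperplane_of a"
proof -
  have "(\<Sum>i\<in>UNIV. c * a $ i * x $ i) = c * (\<Sum>i\<in>UNIV. a $ i * x $ i)" for x
    unfolding sum_distrib_left by (simp only: mult.assoc)
  then show ?thesis using assms by (simp add: hyperplane_of_def)
qed

text \<open>Divisibility makes \<open>b\<close> a multiple of \<open>a\<close>, by a nonzero scalar
  since \<open>b \<noteq> 0\<close>, and such vectors define the same hyperplane.\<close>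

lemma linear_form_not_dvd:
  fixes a b :: "'k::field ^ 'v::finite"
  assumes "a \<noteq> 0" "b \<noteq> 0" "hyperplane_of a \<noteq> hyperplane_of b"
  shows "\<not> linear_form a dvd linear_form b"
  using linear_form_dvd_imp_proportional[OF assms(1)] hyperplane_of_scale assms
  by (metis vector_smult_lzero)

text \<open>No unique factorization is needed: one prime factor of the product is cancelled at a time.\<close>

lemma prod_primes_dvd:
  fixes g :: "('v::finite, 'k::idom) mpoly"
  assumes "finite I" "\<And>i. i \<in> I \<Longrightarrow> prime_elem (p i)"
    and "\<And>i. i \<in> I \<Longrightarrow> \<not> p i dvd s i"
    and "\<And>i. i \<in> I \<Longrightarrow> (\<Prod>j\<in>I. p j) dvd s i * g"
  shows "(\<Prod>j\<in>I. p j) dvd g"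
  using assms
proof (induction I arbitrary: g rule: finite_induct)
  case (insert i I)
  have "p i dvd s i * g"
    using insert.prems(3)[of i] insert.hyps by (auto dest: dvd_mult_left)
  then have "p i dvd g"
    using insert.prems(1,2)[of i] prime_elem_dvd_multD by blast
  then obtain g' where g': "g = p i * g'" by (rule dvdE)
  have "(\<Prod>j\<in>I. p j) dvd s k * g'" if k: "k \<in> I" for k
  proof -
    have "p i * (\<Prod>j\<in>I. p j) dvd s k * (p i * g')"
      using insert.prems(3)[of k] insert.hyps k g' by simp
    then obtain c where "s k * (p i * g') = p i * (\<Prod>j\<in>I. p j) * c" by (rule dvdE)
    then have "p i * (s k * g') = p i * ((\<Prod>j\<in>I. p j) * c)" by (simp only: mult_ac)
    moreover have "p i \<noteq> 0" using insert.prems(1)[of i] by auto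
    ultimately have "s k * g' = (\<Prod>j\<in>I. p j) * c"
      by (metis mpoly_mult_left_cancel)
    then show ?thesis by simp
  qed
  from insert.IH[OF insert.prems(1)[OF insertI2] insert.prems(2)[OF insertI2] this]
  have "(\<Prod>j\<in>I. p j) dvd g'" by simp
  then have "p i * (\<Prod>j\<in>I. p j) dvd p i * g'" by (intro mult_dvd_mono dvd_refl)
  then show ?case using insert.hyps g' by simp
qed simp


section \<open>Height of the prime ideals of codimension two\<close>

text \<open>Linear algebra over the coefficient field supplies the dimension counts, first for the
  height bound and later for numbers of generators.\<close>

interpretation mpoly_space: vector_space "\<lambda>(c::'k::field) (p::('v, 'k) mpoly). pconst c * p"
  by unfold_locales (simp_all add: distrib_left distrib_right single_add mult_single flip: mult.assoc)

text \<open>Each exponent is bounded separately, rather than the total degree, so that the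
  admissible monomials form a box that is easy to count.\<close>

definition exponents_le :: "nat \<Rightarrow> ('v::finite, 'k::comm_ring_1) mpoly set" where
  "exponents_le b = {p. \<forall>m\<in>keys p. \<forall>i. lookup m i \<le> b}"

lemma exponents_le_mult:
  "p \<in> exponents_le a \<Longrightarrow> q \<in> exponents_le b \<Longrightarrow> p * q \<in> exponents_le (a + b)"
  using keys_mult[of p q] by (fastforce simp: exponents_le_def lookup_add intro: add_mono)

lemma exponents_le_power: "p \<in> exponents_le a \<Longrightarrow> p ^ k \<in> exponents_le (k * a)"
proof (induction k)
  case 0
  then show ?case by (simp add: exponents_le_def)
qed (simp add: exponents_le_mult)

lemma exponents_le_mono: "p \<in> exponents_le a \<Longrightarrow> a \<le> b \<Longrightarrow> p \<in> exponents_le b"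
  unfolding exponents_le_def using le_trans by blast

lemma exponents_le_exists: "\<exists>b. p \<in> exponents_le b"
proof -
  let ?E = "\<Union>m\<in>keys p. range (lookup m)"
  have "finite ?E" by simp
  then have "lookup m i \<le> Max ?E" if "m \<in> keys p" for m i
    using that by (intro Max_ge) auto
  then show ?thesis unfolding exponents_le_def by blast
qed

text \<open>Restriction to \<open>S\<close> identifies these exponent vectors with the functions
  from \<open>S\<close> to \<open>{..<M}\<close>; positivity of \<open>M\<close> admits the exponent
  0 off \<open>S\<close>.\<close>

lemma card_monomial_box:
  fixes S :: "'v::finite set"
  assumes "0 < M"
  defines "box \<equiv> {m :: 'v \<Rightarrow>\<^sub>0 nat. keys m \<subseteq> S \<and> (\<forall>i. lookup m i < M)}"
  shows "finite box" "card box = M ^ card S"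
proof -
  have bij: "bij_betw (\<lambda>m. restrict (lookup m) S) box (S \<rightarrow>\<^sub>E {..<M})"
  proof (rule bij_betw_byWitness[where f' = "\<lambda>f. Abs_poly_mapping (\<lambda>i. if i \<in> S then f i else 0)"])
    show "\<forall>m\<in>box. Abs_poly_mapping (\<lambda>i. if i \<in> S then restrict (lookup m) S i else 0) = m"
    proof
      fix m assume "m \<in> box"
      then have "(\<lambda>i. if i \<in> S then restrict (lookup m) S i else 0) = lookup m"
        by (auto simp: box_def in_keys_iff fun_eq_iff subset_iff)
      then show "Abs_poly_mapping (\<lambda>i. if i \<in> S then restrict (lookup m) S i else 0) = m"
        by simp
    qed
    show "\<forall>f\<in>S \<rightarrow>\<^sub>E {..<M}.
        restrict (lookup (Abs_poly_mapping (\<lambda>i. if i \<in> S then f i else 0))) S = f"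
      by (auto simp: fun_eq_iff PiE_def extensional_def)
    show "(\<lambda>m. restrict (lookup m) S) ` box \<subseteq> S \<rightarrow>\<^sub>E {..<M}"
      by (auto simp: box_def)
    show "(\<lambda>f. Abs_poly_mapping (\<lambda>i. if i \<in> S then f i else 0)) ` (S \<rightarrow>\<^sub>E {..<M}) \<subseteq> box"
      using assms(1) by (auto simp: box_def in_keys_iff split: if_splits)
  qed
  show "finite box" using bij_betw_finite[OF bij] by (simp add: finite_PiE)
  show "card box = M ^ card S" using bij_betw_same_card[OF bij] by (simp add: card_PiE)
qed

lemma mpoly_in_span_monomials:
  fixes p :: "('v, 'k::field) mpoly"
  assumes "keys p \<subseteq> X"
  shows "p \<in> mpoly_space.span ((\<lambda>m. single m 1) ` X)"
proof -
  have "p = (\<Sum>m\<in>keys p. single m (lookup p m))"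
    by (rule poly_mapping_eqI) (auto simp: lookup_sum lookup_single when_def in_keys_iff)
  also have "\<dots> = (\<Sum>m\<in>keys p. pconst (lookup p m) * single m 1)"
    by (simp add: mult_single)
  also have "\<dots> \<in> mpoly_space.span ((\<lambda>m. single m 1) ` X)"
    using assms by (intro mpoly_space.span_sum mpoly_space.span_scale mpoly_space.span_base) auto
  finally show ?thesis .
qed

text \<open>For an ideal \<open>C\<close> this is linear independence of the residue classes modulo
  \<open>C\<close>. Indexed families allow counting by index sets before injectivity is
  known.\<close>

definition indep_mod :: "('v, 'k::field) mpoly set \<Rightarrow> 'i set \<Rightarrow> ('i \<Rightarrow> ('v, 'k) mpoly) \<Rightarrow> bool" where
  "indep_mod C I e \<longleftrightarrow> (\<forall>c. (\<Sum>i\<in>I. pconst (c i) * e i) \<in> C \<longrightarrow> (\<forall>i\<in>I. c i = 0))"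

text \<open>Let \<open>z\<close> be the polynomial in \<open>p\<close> that lies in \<open>C\<close>. As \<open>p \<in> C'\<close>, its constant term lies
  in \<open>C'\<close> and therefore vanishes; as \<open>p \<notin> C\<close>, the quotient \<open>z / p\<close> lies in the prime \<open>C\<close> again.\<close>

lemma indep_mod_powers:
  assumes C: "prime_ideal C" and C': "ring_self.subspace C'" "C \<subseteq> C'"
    and p: "p \<in> C'" "p \<notin> C" and I: "finite I" and e: "indep_mod C' I e"
  shows "indep_mod C (I \<times> {..<M}) (\<lambda>(i, k). e i * p ^ k)"
proof (induction M)
  case 0
  then show ?case by (simp add: indep_mod_def)
next
  case (Suc M)
  show ?case
    unfolding indep_mod_def
  proof (intro allI impI)
    fix c :: "_ \<times> nat \<Rightarrow> _"
    define z where "z = (\<Sum>x\<in>I \<times> {..<Suc M}. pconst (c x) * (case x of (i, k) \<Rightarrow> e i * p ^ k))"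
    \<comment> \<open>\<open>a\<close> collects the terms with exponent 0 of \<open>p\<close>, and
      \<open>b\<close> the remaining ones with one factor \<open>p\<close> removed.\<close>
    define a where "a = (\<Sum>i\<in>I. pconst (c (i, 0)) * e i)"
    define b where "b = (\<Sum>x\<in>I \<times> {..<M}. pconst (c (fst x, Suc (snd x))) * (case x of (i, k) \<Rightarrow> e i * p ^ k))"
    have b_eq: "b = (\<Sum>i\<in>I. \<Sum>k<M. pconst (c (i, Suc k)) * (e i * p ^ k))"
      unfolding b_def sum.cartesian_product by (intro sum.cong) auto
    have "z = (\<Sum>i\<in>I. \<Sum>k<Suc M. pconst (c (i, k)) * (e i * p ^ k))"
      unfolding z_def sum.cartesian_product by (intro sum.cong) auto
    also have "\<dots> = (\<Sum>i\<in>I. pconst (c (i, 0)) * e i + (\<Sum>k<M. pconst (c (i, Suc k)) * (e i * p ^ Suc k)))"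
      unfolding sum.lessThan_Suc_shift by simp
    also have "\<dots> = a + (\<Sum>i\<in>I. \<Sum>k<M. p * (pconst (c (i, Suc k)) * (e i * p ^ k)))"
      unfolding sum.distrib a_def power_Suc by (simp only: mult.left_commute)
    also have "\<dots> = a + p * b"
      by (simp only: b_eq sum_distrib_left)
    finally have z: "z = a + p * b" .
    assume "z \<in> C"
    have "p * b \<in> C'" using ring_self.subspace_scale[OF C'(1) p(1), of b] by (simp add: mult.commute)
    then have "a \<in> C'"
      using ring_self.subspace_diff[OF C'(1), of z "p * b"] z \<open>z \<in> C\<close> C'(2) by auto
    then have c0: "\<forall>i\<in>I. c (i, 0) = 0" using e by (auto simp: indep_mod_def a_def)
    then have "a = 0" by (simp add: a_def)
    then have "p * b \<in> C" using z \<open>z \<in> C\<close> by simp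
    then have "b \<in> C" using C p(2) by (auto simp: prime_ideal_def)
    then have "\<forall>x\<in>I \<times> {..<M}. c (fst x, Suc (snd x)) = 0"
      using Suc[unfolded indep_mod_def, THEN spec, of "\<lambda>x. c (fst x, Suc (snd x))"]
      unfolding b_def by simp
    then show "\<forall>x\<in>I \<times> {..<Suc M}. c x = 0"
      using c0 by (auto simp: less_Suc_eq_0_disj)
  qed
qed

text \<open>Since \<open>0 \<in> C\<close>, independence modulo \<open>C\<close> implies plain
  independence, and the monomials with exponents at most \<open>b\<close> span a space of dimension
  at most \<open>(b + 1) ^ CARD('v)\<close>.\<close>

lemma indep_mod_card_le:
  fixes e :: "'i \<Rightarrow> ('v::finite, 'k::field) mpoly"
  assumes e: "indep_mod C I e" and C: "0 \<in> C" and I: "finite I"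
    and b: "\<And>i. i \<in> I \<Longrightarrow> e i \<in> exponents_le b"
  shows "card I \<le> (b + 1) ^ CARD('v)"
proof -
  have zero: "c i = 0" if "(\<Sum>i\<in>I. pconst (c i) * e i) = 0" "i \<in> I" for c i
    using e C that unfolding indep_mod_def by auto
  have inj: "inj_on e I"
  proof (rule inj_onI, rule ccontr)
    fix i j assume ij: "i \<in> I" "j \<in> I" "e i = e j" "i \<noteq> j"
    \<comment> \<open>A coincidence \<open>e i = e j\<close> would give the nontrivial relation
      \<open>e i - e j = 0\<close>.\<close>
    define c :: "'i \<Rightarrow> 'k" where "c k = (if k = i then 1 else 0) - (if k = j then 1 else 0)" for k
    have "pconst (c k) * e k = (if k = i then e k else 0) - (if k = j then e k else 0)" for k
      using ij by (auto simp: c_def single_diff)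
    then have "(\<Sum>k\<in>I. pconst (c k) * e k) = 0"
      using ij I by (simp add: sum_subtractf)
    then have "c i = 0" using zero ij by blast
    then show False using ij by (simp add: c_def)
  qed
  have "mpoly_space.independent (e ` I)"
  proof (rule mpoly_space.independent_if_scalars_zero)
    fix f x assume "(\<Sum>x\<in>e ` I. pconst (f x) * x) = 0" and x: "x \<in> e ` I"
    then have "(\<Sum>i\<in>I. pconst (f (e i)) * e i) = 0" using inj by (simp add: sum.reindex)
    then show "f x = 0" using zero[of "\<lambda>i. f (e i)"] x by blast
  qed (use I in simp)
  define box where "box = {m :: 'v \<Rightarrow>\<^sub>0 nat. keys m \<subseteq> UNIV \<and> (\<forall>i. lookup m i < Suc b)}"
  have box: "finite box" "card box = Suc b ^ CARD('v)"
    unfolding box_def using card_monomial_box[of "Suc b" UNIV] by simp_all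
  have "e i \<in> mpoly_space.span ((\<lambda>m. single m 1) ` box)" if "i \<in> I" for i
    using b[OF that]
    by (intro mpoly_in_span_monomials) (auto simp: exponents_le_def box_def less_Suc_eq_le)
  then have "e ` I \<subseteq> mpoly_space.span ((\<lambda>m. single m 1) ` box)" by (rule image_subsetI)
  with \<open>mpoly_space.independent (e ` I)\<close>
  have "card (e ` I) \<le> card ((\<lambda>m. single m (1::'k)) ` box)"
    using mpoly_space.independent_span_bound[OF finite_imageI[OF box(1)]] by blast
  also have "\<dots> \<le> card box" using box(1) by (rule card_image_le)
  finally show ?thesis using box(2) by (simp add: card_image[OF inj])
qed

text \<open>A chain of length three below \<open>P\<close> would give \<open>M ^ (CARD('v) + 1)\<close> linearly independent
  polynomials with exponents bounded by a fixed multiple of \<open>M\<close>.\<close>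

lemma no_prime_chain_below_codim_two:
  fixes P :: "('v::finite, 'k::field) mpoly set"
  assumes C: "prime_ideal C0" "prime_ideal C1" "prime_ideal C2" "prime_ideal P"
    and sub: "C0 \<subset> C1" "C1 \<subset> C2" "C2 \<subset> P"
    and uv: "u \<noteq> v"
    and P: "\<And>h. h \<in> P \<Longrightarrow> (\<And>m. m \<in> keys h \<Longrightarrow> lookup m u = 0 \<and> lookup m v = 0) \<Longrightarrow> h = 0"
  shows False
proof -
  let ?N = "CARD('v)"
  obtain p q r where p: "p \<in> C1" "p \<notin> C0" and q: "q \<in> C2" "q \<notin> C1" and r: "r \<in> P" "r \<notin> C2"
    using sub by blast
  have ideal: "ring_self.subspace C0" "ring_self.subspace C1" "ring_self.subspace C2"
    "ring_self.subspace P"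
    using C by (auto simp: prime_ideal_def)
  obtain bp bq br where "p \<in> exponents_le bp" "q \<in> exponents_le bq" "r \<in> exponents_le br"
    using exponents_le_exists by metis
  then obtain b where b: "p \<in> exponents_le b" "q \<in> exponents_le b" "r \<in> exponents_le b"
    by (metis exponents_le_mono max.cobounded1 max.cobounded2)
  \<comment> \<open>\<open>M * K\<close> bounds \<open>1 + M + 3 * M * b\<close>, the number of
    values open to each exponent below, and \<open>M > K ^ ?N\<close> makes
    \<open>M ^ (?N + 1)\<close> exceed \<open>(M * K) ^ ?N\<close>.\<close>
  define K where "K = 2 + 3 * b"
  define M where "M = K ^ ?N + 1"
  have M: "0 < M" by (simp add: M_def)
  define S where "S = - {u, v}"
  define Z where "Z = {m :: 'v \<Rightarrow>\<^sub>0 nat. keys m \<subseteq> S \<and> (\<forall>i. lookup m i < M)}"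
  have Z: "finite Z" "card Z = M ^ card S" unfolding Z_def using card_monomial_box[OF M] by auto
  have S: "card S + 2 = ?N"
  proof -
    have "card S = ?N - card {u, v}" unfolding S_def by (simp add: Compl_eq_Diff_UNIV card_Diff_subset)
    moreover have "card {u, v} \<le> ?N" by (rule card_mono) auto
    ultimately show ?thesis using uv by simp
  qed
  \<comment> \<open>A linear combination of monomials in \<open>Z\<close> involves neither
    \<open>u\<close> nor \<open>v\<close>, so by the assumption on \<open>P\<close> it lies in
    \<open>P\<close> only if it is zero.\<close>
  have I0: "indep_mod P Z (\<lambda>m. single m 1)"
    unfolding indep_mod_def
  proof (intro allI impI)
    fix c :: "('v \<Rightarrow>\<^sub>0 nat) \<Rightarrow> 'k"
    define h where "h = (\<Sum>m\<in>Z. pconst (c m) * single m 1)"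
    have lookup_h: "lookup h m = (if m \<in> Z then c m else 0)" for m
      using Z(1) by (simp add: h_def mult_single lookup_sum lookup_single when_def)
    assume "h \<in> P"
    moreover have "lookup m u = 0 \<and> lookup m v = 0" if "m \<in> keys h" for m
    proof -
      have "m \<in> Z" using that by (auto simp: in_keys_iff lookup_h split: if_splits)
      then show ?thesis by (auto simp: Z_def S_def in_keys_iff)
    qed
    ultimately have "h = 0" using P by blast
    then show "\<forall>m\<in>Z. c m = 0" using lookup_h by (metis lookup_zero)
  qed
  \<comment> \<open>Each of the three steps down the chain multiplies the family by powers of an
    element of the larger prime outside the smaller one, gaining a factor \<open>M\<close> in
    size.\<close>
  define e1 where "e1 = (\<lambda>(m, k). single m (1::'k) * r ^ k)"
  have I1: "indep_mod C2 (Z \<times> {..<M}) e1"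
    unfolding e1_def using sub by (intro indep_mod_powers[OF C(3) ideal(4) _ r Z(1) I0]) auto
  define e2 where "e2 = (\<lambda>(i, k). e1 i * q ^ k)"
  have I2: "indep_mod C1 ((Z \<times> {..<M}) \<times> {..<M}) e2"
    unfolding e2_def using sub Z(1) by (intro indep_mod_powers[OF C(2) ideal(3) _ q _ I1]) auto
  define e3 where "e3 = (\<lambda>(i, k). e2 i * p ^ k)"
  let ?I = "((Z \<times> {..<M}) \<times> {..<M}) \<times> {..<M}"
  have I3: "indep_mod C0 ?I e3"
    unfolding e3_def using sub Z(1) by (intro indep_mod_powers[OF C(1) ideal(2) _ p _ I2]) auto
  have "card ?I \<le> (M + M * b + M * b + M * b + 1) ^ ?N"
  proof (rule indep_mod_card_le[OF I3])
    fix x assume x: "x \<in> ?I"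
    then obtain m i j k where mijk: "x = (((m, i), j), k)" "m \<in> Z" "i < M" "j < M" "k < M" by auto
    have "single m 1 \<in> exponents_le M" using mijk(2) by (auto simp: exponents_le_def Z_def less_imp_le)
    moreover have "s ^ l \<in> exponents_le (M * b)" if "s \<in> exponents_le b" "l < M"
      for s :: "('v, 'k) mpoly" and l
      using exponents_le_power[OF that(1), of l] that(2)
      by (auto elim!: exponents_le_mono intro!: mult_right_mono)
    ultimately show "e3 x \<in> exponents_le (M + M * b + M * b + M * b)"
      unfolding e3_def e2_def e1_def mijk(1) prod.case using b mijk by (intro exponents_le_mult) auto
  qed (use ideal Z(1) in \<open>auto simp: ring_self.subspace_0\<close>)
  also have "\<dots> \<le> (M * K) ^ ?N"
    using M by (intro power_mono) (auto simp: K_def algebra_simps)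
  also have "\<dots> = K ^ ?N * M ^ ?N" by (simp add: power_mult_distrib mult.commute)
  also have "\<dots> < M * M ^ ?N" using M by (intro mult_strict_right_mono) (auto simp: M_def)
  also have "\<dots> = card ?I"
    by (simp add: card_cartesian_product Z(2) flip: S)
  finally show False by simp
qed

lemma prime_height_le_2:
  fixes P :: "('v::finite, 'k::field) mpoly set"
  assumes "u \<noteq> v"
    and "\<And>h. h \<in> P \<Longrightarrow> (\<And>m. m \<in> keys h \<Longrightarrow> lookup m u = 0 \<and> lookup m v = 0) \<Longrightarrow> h = 0"
  shows "prime_height P \<le> 2"
  unfolding prime_height_def
proof (rule Sup_least, clarify)
  fix k :: nat and C :: "nat \<Rightarrow> ('v, 'k) mpoly set"
  assume C: "\<forall>i\<le>k. prime_ideal (C i)" "\<forall>i<k. C i \<subset> C (Suc i)" and P: "P = C k"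
  have "k \<le> 2"
  proof (rule ccontr)
    assume "\<not> k \<le> 2"
    \<comment> \<open>A chain with \<open>k \<ge> 3\<close> contains four consecutive primes ending
      in \<open>P = C k\<close>.\<close>
    then obtain j where j: "k = Suc (Suc (Suc j))"
      by (auto dest!: less_imp_Suc_add simp: not_le numeral_2_eq_2)
    have "prime_ideal (C j)" "prime_ideal (C (Suc j))" "prime_ideal (C (Suc (Suc j)))" "prime_ideal P"
      using C(1) P j by simp_all
    moreover have "C j \<subset> C (Suc j)" "C (Suc j) \<subset> C (Suc (Suc j))" "C (Suc (Suc j)) \<subset> P"
      using C(2) P j by simp_all
    ultimately show False
      using assms by (rule no_prime_chain_below_codim_two)
  qed
  then show "enat k \<le> 2" by (metis enat_ord_simps(1) numeral_eq_enat)
qed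


section \<open>The Jacobian ideal of an arrangement\<close>

lemma partial_deriv_add: "partial_deriv i (p + q) = partial_deriv i p + partial_deriv i q"
  unfolding partial_deriv_def
  by (rule setsum_keys_plus_distrib
      [where f = "\<lambda>m c. single (m - single i 1) (of_nat (lookup m i) * c)"])
    (simp_all add: single_add distrib_left)

lemma partial_deriv_single:
  "partial_deriv i (single m c) = single (m - single i 1) (of_nat (lookup m i) * c)"
  by (simp add: partial_deriv_def)

lemma partial_deriv_0 [simp]: "partial_deriv i 0 = 0"
  by (simp add: partial_deriv_def)

lemma partial_deriv_1 [simp]: "partial_deriv i 1 = 0"
  using partial_deriv_single[of i 0 1] by simp

lemma partial_deriv_sum: "partial_deriv i (\<Sum>x\<in>X. h x) = (\<Sum>x\<in>X. partial_deriv i (h x))"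
  by (induction X rule: infinite_finite_induct) (simp_all add: partial_deriv_add)

lemma partial_deriv_mult:
  "partial_deriv i (p * q) = partial_deriv i p * q + p * partial_deriv i q"
proof (induction p rule: poly_mapping_single_add_induct)
  case (single m c)
  show ?case
  proof (induction q rule: poly_mapping_single_add_induct)
    case (single m' c')
    \<comment> \<open>Subtraction of exponents is truncated. It differs from true subtraction only
      if the exponent of \<open>i\<close> in \<open>n'\<close> is 0, and then the coefficient
      vanishes.\<close>
    have shift: "single (n + (n' - single i 1)) (of_nat (lookup n' i) * x)
        = single (n + n' - single i 1) (of_nat (lookup n' i) * x)" for n n' and x :: 'b
    proof (cases "lookup n' i = 0")
      case False
      then have "n + (n' - single i 1) = n + n' - single i 1"
        by (intro poly_mapping_eqI) (auto simp: lookup_add lookup_minus lookup_single when_def)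
      then show ?thesis by simp
    qed simp
    have "partial_deriv i (single m c) * single m' c'
        = single (m' + (m - single i 1)) (of_nat (lookup m i) * (c * c'))"
      unfolding partial_deriv_single mult_single mult.assoc add.commute[of m'] ..
    then have 1: "partial_deriv i (single m c) * single m' c'
        = single (m + m' - single i 1) (of_nat (lookup m i) * (c * c'))"
      unfolding shift add.commute[of m' m] .
    have "single m c * partial_deriv i (single m' c')
        = single (m + (m' - single i 1)) (of_nat (lookup m' i) * (c * c'))"
      unfolding partial_deriv_single mult_single mult.left_commute[of c] ..
    then have 2: "single m c * partial_deriv i (single m' c')
        = single (m + m' - single i 1) (of_nat (lookup m' i) * (c * c'))"
      unfolding shift .
    show ?case
      unfolding 1 2
      by (simp add: mult_single partial_deriv_single lookup_add distrib_right single_add)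
  next
    case (add p q)
    then show ?case by (simp add: distrib_left partial_deriv_add add_ac)
  qed
next
  case (add p q)
  then show ?case by (simp add: distrib_right partial_deriv_add add_ac)
qed

lemma partial_deriv_prod:
  assumes "finite X"
  shows "partial_deriv i (\<Prod>x\<in>X. h x) = (\<Sum>x\<in>X. partial_deriv i (h x) * (\<Prod>y\<in>X - {x}. h y))"
  using assms
proof (induction X rule: finite_induct)
  case (insert x X)
  have "(\<Prod>z\<in>insert x X - {y}. h z) = h x * (\<Prod>z\<in>X - {y}. h z)" if "y \<in> X" for y
  proof -
    have "insert x X - {y} = insert x (X - {y})" using that insert.hyps by auto
    then show ?thesis using insert.hyps by simp
  qed
  then have "(\<Sum>y\<in>X. partial_deriv i (h y) * (\<Prod>z\<in>insert x X - {y}. h z))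
      = h x * (\<Sum>y\<in>X. partial_deriv i (h y) * (\<Prod>z\<in>X - {y}. h z))"
    unfolding sum_distrib_left by (intro sum.cong) (simp_all add: mult.left_commute)
  then show ?case using insert by (simp add: partial_deriv_mult)
qed simp

lemma partial_deriv_linear_form: "partial_deriv i (linear_form a) = pconst (a $ i)"
proof -
  have "partial_deriv i (single (single j 1) (a $ j)) = (if j = i then pconst (a $ i) else 0)" for j
    by (simp add: partial_deriv_single lookup_single when_def)
  then show ?thesis
    unfolding linear_form_def partial_deriv_sum by simp
qed

section \<open>Constructions and properties of prime ideals\<close>

lemma prime_ideal_principal:
  assumes "prime_elem p"
  shows "prime_ideal {h. p dvd h}"
proof -
  have "ring_self.subspace {h. p dvd h}" by (rule ring_self.subspaceI) auto
  then show ?thesis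
    using assms by (auto simp: prime_ideal_def prime_elem_def)
qed

lemma prime_ideal_zero: "prime_ideal {0 :: ('v::finite, 'k::idom) mpoly}"
proof -
  have "ring_self.subspace {0 :: ('v, 'k) mpoly}" by (rule ring_self.subspaceI) auto
  moreover have "(1 :: ('v, 'k) mpoly) \<notin> {0}" by simp
  then have "{0 :: ('v, 'k) mpoly} \<noteq> UNIV" by blast
  ultimately show ?thesis by (simp add: prime_ideal_def mpoly_mult_eq_0_iff)
qed

lemma prime_ideal_1: "prime_ideal P \<Longrightarrow> 1 \<notin> P"
  unfolding prime_ideal_def using ring_self.subspace_scale[of P 1] by auto

lemma prime_ideal_prodD:
  assumes "prime_ideal P" "(\<Prod>x\<in>X. h x) \<in> P"
  shows "\<exists>x\<in>X. h x \<in> P"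
  using assms(2)
proof (induction X rule: infinite_finite_induct)
  case (insert x X)
  then show ?case using assms(1) by (auto simp: prime_ideal_def)
qed (use prime_ideal_1[OF assms(1)] in auto)

lemma prime_ideal_vimage:
  assumes "prime_ideal P" "\<phi> 1 = 1" "\<And>p q. \<phi> (p + q) = \<phi> p + \<phi> q"
    "\<And>p q. \<phi> (p * q) = \<phi> p * \<phi> q"
  shows "prime_ideal {h. \<phi> h \<in> P}"
proof -
  have P: "ring_self.subspace P" using assms(1) by (simp add: prime_ideal_def)
  have "\<phi> 0 = 0" using assms(3)[of 0 0] by simp
  then have "ring_self.subspace {h. \<phi> h \<in> P}"
    using ring_self.subspace_0[OF P] ring_self.subspace_add[OF P] ring_self.subspace_scale[OF P]
    by (intro ring_self.subspaceI) (simp_all add: assms)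
  moreover have "1 \<notin> {h. \<phi> h \<in> P}" using prime_ideal_1[OF assms(1)] assms(2) by simp
  then have "{h. \<phi> h \<in> P} \<noteq> UNIV" by blast
  ultimately show ?thesis using assms(1) by (simp add: prime_ideal_def assms(4))
qed

section \<open>Arrangements with one linear form chosen for each hyperplane\<close>

locale arrangement_forms =
  fixes A :: "('k::field_char_0 ^ 'v::finite) set set" and a :: "('k ^ 'v) set \<Rightarrow> 'k ^ 'v"
  assumes finite: "finite A" and nonempty: "A \<noteq> {}"
    and nonzero: "H \<in> A \<Longrightarrow> a H \<noteq> 0" and hyperplane: "H \<in> A \<Longrightarrow> hyperplane_of (a H) = H"
begin

abbreviation form :: "('k ^ 'v) set \<Rightarrow> ('v, 'k) mpoly" where
  "form H \<equiv> linear_form (a H)"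

definition defpoly :: "('v, 'k) mpoly" where
  "defpoly = (\<Prod>H\<in>A. form H)"

definition cofactor :: "('k ^ 'v) set \<Rightarrow> ('v, 'k) mpoly" where
  "cofactor H = (\<Prod>H'\<in>A - {H}. form H')"

lemma defpoly_eq: "H \<in> A \<Longrightarrow> defpoly = form H * cofactor H"
  unfolding defpoly_def cofactor_def by (rule prod.remove[OF finite])

lemma prime_form: "H \<in> A \<Longrightarrow> prime_elem (form H)"
  using nonzero by (rule prime_elem_linear_form)

lemma form_not_dvd_form: "H \<in> A \<Longrightarrow> H' \<in> A \<Longrightarrow> H \<noteq> H' \<Longrightarrow> \<not> form H dvd form H'"
  using linear_form_not_dvd[of "a H" "a H'"] nonzero hyperplane by simp

lemma form_not_dvd_cofactor:
  assumes "H \<in> A"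
  shows "\<not> form H dvd cofactor H"
proof
  assume "form H dvd cofactor H"
  then have "\<exists>H'\<in>A - {H}. form H' \<in> {h. form H dvd h}"
    unfolding cofactor_def using prime_ideal_principal[OF prime_form[OF assms]]
    by (intro prime_ideal_prodD) auto
  then show False using form_not_dvd_form assms by blast
qed

lemma form_dvd_cofactor: "H \<in> A \<Longrightarrow> H' \<in> A \<Longrightarrow> H \<noteq> H' \<Longrightarrow> form H dvd cofactor H'"
  unfolding cofactor_def by (rule dvd_prodI) (use finite in auto)

lemma partial_deriv_defpoly: "partial_deriv i defpoly = (\<Sum>H\<in>A. pconst (a H $ i) * cofactor H)"
  unfolding defpoly_def partial_deriv_prod[OF finite] partial_deriv_linear_form cofactor_def ..

text \<open>In the product rule every summand except that of \<open>H\<close> keeps the factor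
  \<open>form H\<close>.\<close>

lemma form_dvd_partial_deriv_diff:
  assumes "H \<in> A"
  shows "form H dvd partial_deriv i defpoly - pconst (a H $ i) * cofactor H"
proof -
  have "partial_deriv i defpoly - pconst (a H $ i) * cofactor H
      = (\<Sum>H'\<in>A - {H}. pconst (a H' $ i) * cofactor H')"
    unfolding partial_deriv_defpoly sum.remove[OF finite assms] by simp
  also have "form H dvd \<dots>"
    using form_dvd_cofactor assms by (intro dvd_sum dvd_mult) auto
  finally show ?thesis .
qed

lemma partial_deriv_in_Jac: "partial_deriv i h \<in> Jac h"
  unfolding Jac_def by (rule ring_self.span_base) simp

text \<open>Any \<open>i\<close> with \<open>a H $ i \<noteq> 0\<close> works: modulo
  \<open>form H\<close> the derivative is a nonzero scalar times \<open>cofactor H\<close>. Hence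
  the Jacobian ideal lies in no principal ideal of a \<open>form H\<close>.\<close>

lemma exists_partial_deriv_not_dvd:
  assumes "H \<in> A"
  shows "\<exists>i. \<not> form H dvd partial_deriv i defpoly"
proof -
  obtain i where i: "a H $ i \<noteq> 0" using nonzero[OF assms] by (auto simp: vec_eq_iff)
  have "\<not> form H dvd partial_deriv i defpoly"
  proof
    assume "form H dvd partial_deriv i defpoly"
    then have "form H dvd partial_deriv i defpoly
        - (partial_deriv i defpoly - pconst (a H $ i) * cofactor H)"
      by (rule dvd_diff) (rule form_dvd_partial_deriv_diff[OF assms])
    then have "form H dvd pconst (1 / a H $ i) * (pconst (a H $ i) * cofactor H)"
      by (intro dvd_mult[of _ "pconst (a H $ i) * cofactor H"]) simp
    also have "pconst (1 / a H $ i) * (pconst (a H $ i) * cofactor H) = cofactor H"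
      using i by (simp add: mult_single flip: mult.assoc)
    finally show False using form_not_dvd_cofactor[OF assms] by blast
  qed
  then show ?thesis ..
qed

text \<open>After the sums are exchanged, the variables and the coefficients of \<open>a H\<close>
  reassemble \<open>form H\<close>, which completes \<open>cofactor H\<close> to
  \<open>defpoly\<close>.\<close>

lemma euler: "(\<Sum>i\<in>UNIV. pvar i * partial_deriv i defpoly) = of_nat (card A) * defpoly"
proof -
  have "(\<Sum>i\<in>UNIV. pvar i * partial_deriv i defpoly)
      = (\<Sum>H\<in>A. \<Sum>i\<in>UNIV. pvar i * (pconst (a H $ i) * cofactor H))"
    unfolding partial_deriv_defpoly sum_distrib_left by (rule sum.swap)
  also have "\<dots> = (\<Sum>H\<in>A. defpoly)"
  proof (rule sum.cong[OF refl])
    fix H assume H: "H \<in> A"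
    have "(\<Sum>i\<in>UNIV. pvar i * (pconst (a H $ i) * cofactor H)) = form H * cofactor H"
      unfolding linear_form_altdef sum_distrib_right
      by (intro sum.cong refl) (simp only: mult.assoc mult.left_commute)
    then show "(\<Sum>i\<in>UNIV. pvar i * (pconst (a H $ i) * cofactor H)) = defpoly"
      using defpoly_eq[OF H] by simp
  qed
  finally show ?thesis by simp
qed

text \<open>Characteristic zero and \<open>A \<noteq> {}\<close> make the factor
  \<open>of_nat (card A)\<close> in Euler's relation invertible.\<close>

lemma defpoly_in_Jac: "defpoly \<in> Jac defpoly"
proof -
  have "of_nat (card A) * defpoly \<in> Jac defpoly"
    unfolding euler[symmetric] Jac_def
    by (intro ring_self.span_sum ring_self.span_scale ring_self.span_base) simp
  then have "pconst (1 / of_nat (card A)) * (of_nat (card A) * defpoly) \<in> Jac defpoly"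
    unfolding Jac_def by (rule ring_self.span_scale)
  moreover have "pconst (1 / of_nat (card A)) * (of_nat (card A) * defpoly) = defpoly"
    using finite nonempty
    by (simp add: mult_single flip: mult.assoc single_of_nat)
  ultimately show ?thesis by simp
qed

text \<open>\<open>P\<close> contains \<open>defpoly\<close>, hence some \<open>form H\<close>. The
  chain of zero, the multiples of \<open>form H\<close>, and \<open>P\<close> is strict because some
  partial derivative is not such a multiple.\<close>

lemma prime_height_ge_2:
  assumes P: "prime_ideal P" "Jac defpoly \<subseteq> P"
  shows "2 \<le> prime_height P"
proof -
  have "(\<Prod>H\<in>A. form H) \<in> P" using defpoly_in_Jac P(2) by (auto simp: defpoly_def)
  then obtain H where H: "H \<in> A" "form H \<in> P" using prime_ideal_prodD[OF P(1)] by blast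
  define C where "C j = (if j = 0 then {0} else if j = 1 then {h. form H dvd h} else P)" for j :: nat
  have idealP: "ring_self.subspace P" using P(1) by (simp add: prime_ideal_def)
  have "prime_ideal (C j)" for j
    using P(1) prime_ideal_principal[OF prime_form[OF H(1)]]
    by (simp add: C_def prime_ideal_zero)
  moreover have "C j \<subset> C (Suc j)" if "j < 2" for j
  proof (cases "j = 0")
    case True
    have "form H \<noteq> 0" using nonzero[OF H(1)] by simp
    then have "{0} \<subset> {h. form H dvd h}"
      by (intro psubsetI) (auto simp: set_eq_iff intro!: exI[of _ "form H"])
    then show ?thesis using True by (simp add: C_def)
  next
    case False
    then have j: "j = 1" using that by simp
    have "h \<in> P" if "form H dvd h" for h
      using that ring_self.subspace_scale[OF idealP H(2)] by (auto simp: mult.commute elim!: dvdE)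
    moreover obtain i where "\<not> form H dvd partial_deriv i defpoly"
      using exists_partial_deriv_not_dvd[OF H(1)] by blast
    moreover have "partial_deriv i defpoly \<in> P" using partial_deriv_in_Jac P(2) by blast
    ultimately have "{h. form H dvd h} \<subset> P" by blast
    then show ?thesis using j by (simp add: C_def)
  qed
  moreover have "C 2 = P" by (simp add: C_def)
  ultimately have "enat 2 \<in> {enat k | k. \<exists>C :: nat \<Rightarrow> ('v, 'k) mpoly set.
     (\<forall>i\<le>k. prime_ideal (C i)) \<and> (\<forall>i<k. C i \<subset> C (Suc i)) \<and> C k = P}"
    by blast
  then have "enat 2 \<le> prime_height P" unfolding prime_height_def by (rule Sup_upper)
  then show ?thesis by (simp add: numeral_eq_enat)
qed

lemma cofactor_graded_piece:
  assumes "H \<in> A"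
  shows "cofactor H \<in> graded_piece (card A - 1)"
proof -
  have "cofactor H \<in> graded_piece (\<Sum>H'\<in>A - {H}. 1)"
    unfolding cofactor_def by (intro graded_piece_prod linear_form_graded_piece)
  then show ?thesis using finite assms by simp
qed

lemma defpoly_graded_piece: "defpoly \<in> graded_piece (card A)"
proof -
  have "defpoly \<in> graded_piece (\<Sum>H\<in>A. 1)"
    unfolding defpoly_def by (intro graded_piece_prod linear_form_graded_piece)
  then show ?thesis by simp
qed

lemma partial_deriv_defpoly_graded_piece: "partial_deriv i defpoly \<in> graded_piece (card A - 1)"
  unfolding partial_deriv_defpoly
proof (rule graded_piece_sum)
  fix H assume "H \<in> A"
  then show "pconst (a H $ i) * cofactor H \<in> graded_piece (card A - 1)"
    using graded_piece_mult[OF graded_piece_pconst cofactor_graded_piece] by simp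
qed

text \<open>Localization at the codimension two flat \<open>H \<inter> H'\<close>: the components of height two
  contained in its prime ideal \<open>P\<close> are exactly the components contained in \<open>P\<close>.\<close>

lemma height_two_part_local:
  assumes D: "primary_decomposition D (Jac defpoly)" and g: "g \<in> height_two_part D"
    and H: "H \<in> A" "H' \<in> A" "H \<noteq> H'" and u: "a H $ u \<noteq> 0"
  shows "\<exists>s. \<not> eliminate (a H) u (form H') dvd eliminate (a H) u s \<and> s * g \<in> Jac defpoly"
proof -
  define b where "b = a H' - (a H' $ u / a H $ u) *s a H"
  have lam: "eliminate (a H) u (form H') = linear_form b"
    unfolding b_def by (rule eliminate_linear_form)
  have "eliminate (a H) u (form H') \<noteq> 0"
    unfolding eliminate_eq_0_iff[OF u] using form_not_dvd_form[OF H] .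
  then have b0: "b \<noteq> 0" unfolding lam by simp
  have bu: "b $ u = 0" using u by (simp add: b_def)
  obtain v where v: "b $ v \<noteq> 0" using b0 by (auto simp: vec_eq_iff)
  have uv: "u \<noteq> v" using bu v by auto
  \<comment> \<open>This is the ideal generated by \<open>form H\<close> and \<open>form H'\<close>,
    written as a preimage of a principal prime so that primality is inherited.\<close>
  define P where "P = {h. eliminate (a H) u h \<in> {h. linear_form b dvd h}}"
  have P: "prime_ideal P"
    unfolding P_def using prime_ideal_principal[OF prime_elem_linear_form[OF b0]]
    by (rule prime_ideal_vimage) (simp_all add: eliminate_add eliminate_mult)
  \<comment> \<open>\<open>form H\<close> eliminates \<open>u\<close> and
    \<open>linear_form b\<close> eliminates \<open>v\<close>. Polynomials in the other variables are
    fixed by both eliminations, while those in \<open>P\<close> are sent to zero.\<close>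
  have height_P: "prime_height P \<le> 2"
    using uv
  proof (rule prime_height_le_2)
    fix h assume "h \<in> P" and h: "\<And>m. m \<in> keys h \<Longrightarrow> lookup m u = 0 \<and> lookup m v = 0"
    then have "linear_form b dvd eliminate (a H) u h" by (simp add: P_def)
    also have "eliminate (a H) u h = h" using h by (intro eliminate_ident) simp
    finally have "eliminate b v h = 0" using eliminate_eq_0_iff[of b v h] v by simp
    also have "eliminate b v h = h" using h by (intro eliminate_ident) simp
    finally show "h = 0" by simp
  qed
  have finD: "finite D" and primD: "\<And>Q. Q \<in> D \<Longrightarrow> ring_self.subspace Q"
    and capD: "\<Inter>D = Jac defpoly"
    using D by (auto simp: primary_decomposition_def primary_ideal_def)
  \<comment> \<open>\<open>P\<close> bounds the infimum from above; every prime over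
    \<open>Q\<close> contains the Jacobian ideal and so has height at least 2.\<close>
  have height_Q: "ideal_height Q = 2" if "Q \<in> D" "Q \<subseteq> P" for Q
  proof (rule antisym)
    have "ideal_height Q \<le> prime_height P"
      unfolding ideal_height_def using P that by (intro Inf_lower) auto
    then show "ideal_height Q \<le> 2" using height_P by (rule order_trans)
    have "Jac defpoly \<subseteq> Q" using capD that by blast
    then show "2 \<le> ideal_height Q"
      unfolding ideal_height_def by (intro Inf_greatest) (auto intro!: prime_height_ge_2)
  qed
  \<comment> \<open>One element outside \<open>P\<close> is taken from each component not contained
    in \<open>P\<close>. Their product \<open>s\<close> lies in all these components, but not in the
    prime \<open>P\<close>; the other components contain \<open>g\<close>.\<close>
  define B where "B = {Q \<in> D. \<not> Q \<subseteq> P}"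
  have "\<forall>Q\<in>B. \<exists>s. s \<in> Q \<and> s \<notin> P" by (auto simp: B_def)
  then obtain t where t: "\<And>Q. Q \<in> B \<Longrightarrow> t Q \<in> Q \<and> t Q \<notin> P" by metis
  define s where "s = (\<Prod>Q\<in>B. t Q)"
  have finB: "finite B" using finD by (simp add: B_def)
  have "s \<notin> P" using prime_ideal_prodD[OF P, of t B] t by (auto simp: s_def)
  moreover have "s * g \<in> Q" if Q: "Q \<in> D" for Q
  proof (cases "Q \<subseteq> P")
    case True
    then have "g \<in> Q" using g height_Q Q by (auto simp: height_two_part_def)
    then show ?thesis by (rule ring_self.subspace_scale[OF primD[OF Q]])
  next
    case False
    then have QB: "Q \<in> B" using Q by (simp add: B_def)
    have "s * g = ((\<Prod>Q'\<in>B - {Q}. t Q') * g) * t Q"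
      unfolding s_def prod.remove[OF finB QB] by (simp only: mult.assoc mult.commute mult.left_commute)
    also have "\<dots> \<in> Q" using t[OF QB] by (intro ring_self.subspace_scale[OF primD[OF Q]]) simp
    finally show ?thesis .
  qed
  ultimately show ?thesis
    unfolding capD[symmetric] lam P_def by blast
qed

lemma form_dvd_low_degree:
  assumes D: "primary_decomposition D (Jac defpoly)" and g: "g \<in> height_two_part D"
    and deg: "g \<in> graded_piece e" "e < card A - 1" and H: "H \<in> A"
  shows "form H dvd g"
proof -
  obtain u where u: "a H $ u \<noteq> 0" using nonzero[OF H] by (auto simp: vec_eq_iff)
  let ?\<rho> = "eliminate (a H) u"
  define F where "F = (\<Prod>H'\<in>A - {H}. ?\<rho> (form H'))"
  have F: "F = ?\<rho> (cofactor H)" by (simp add: F_def cofactor_def eliminate_prod)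
  have dvd_Jac: "F dvd ?\<rho> h" if "h \<in> Jac defpoly" for h
  proof -
    have "ring_self.subspace {h. F dvd ?\<rho> h}"
      by (rule ring_self.subspaceI) (simp_all add: eliminate_add eliminate_mult)
    moreover have "F dvd ?\<rho> (partial_deriv i defpoly)" for i
    proof -
      have "partial_deriv i defpoly = (partial_deriv i defpoly - pconst (a H $ i) * cofactor H)
          + pconst (a H $ i) * cofactor H" by simp
      also have "?\<rho> \<dots> = pconst (a H $ i) * F"
        using form_dvd_partial_deriv_diff[OF H, of i]
        unfolding eliminate_add eliminate_eq_0_iff[OF u, symmetric] by (simp add: eliminate_mult F)
      finally show ?thesis by simp
    qed
    ultimately have "Jac defpoly \<subseteq> {h. F dvd ?\<rho> h}"
      unfolding Jac_def by (intro ring_self.span_minimal) auto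
    then show ?thesis using that by blast
  qed
  have "\<forall>H'\<in>A - {H}. \<exists>s. \<not> ?\<rho> (form H') dvd ?\<rho> s \<and> s * g \<in> Jac defpoly"
    using height_two_part_local[OF D g H _ _ u] by blast
  then obtain s where s: "\<And>H'. H' \<in> A - {H} \<Longrightarrow>
      \<not> ?\<rho> (form H') dvd ?\<rho> (s H') \<and> s H' * g \<in> Jac defpoly"
    by metis
  \<comment> \<open>Every \<open>H'\<close> has its own multiplier \<open>s H'\<close>. If several
    hyperplanes meet \<open>H\<close> in the same flat, their forms become proportional under
    \<open>?\<rho>\<close>; \<open>prod_primes_dvd\<close> permits such repeated factors.\<close>
  have "F dvd ?\<rho> g"
    unfolding F_def
  proof (rule prod_primes_dvd)
    show "finite (A - {H})" using finite by simp
  next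
    fix H' assume H': "H' \<in> A - {H}"
    then have "?\<rho> (form H') \<noteq> 0"
      unfolding eliminate_eq_0_iff[OF u] using form_not_dvd_form[OF H] by auto
    then show "prime_elem (?\<rho> (form H'))"
      unfolding eliminate_linear_form by (intro prime_elem_linear_form) auto
    show "\<not> ?\<rho> (form H') dvd ?\<rho> (s H')" using s[OF H'] by blast
    show "(\<Prod>H'\<in>A - {H}. ?\<rho> (form H')) dvd ?\<rho> (s H') * ?\<rho> g"
      using dvd_Jac[of "s H' * g"] s[OF H'] by (simp add: F_def eliminate_mult)
  qed
  moreover have "F \<in> graded_piece (card A - 1)"
    unfolding F using cofactor_graded_piece[OF H] by (rule eliminate_graded_piece)
  ultimately have "?\<rho> g = 0"
    using homogeneous_dvd_low_degree_eq_0 eliminate_graded_piece[OF deg(1)] deg(2) by blast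
  then show ?thesis unfolding eliminate_eq_0_iff[OF u] .
qed

lemma height_two_part_low_degree:
  assumes D: "primary_decomposition D (Jac defpoly)" and g: "g \<in> height_two_part D"
    and deg: "g \<in> graded_piece e" "e < card A - 1"
  shows "g = 0"
proof -
  have "(\<Prod>H\<in>A. form H) dvd g"
  \<comment> \<open>The cofactors are the multipliers: \<open>cofactor H\<close> supplies all
    factors other than \<open>form H\<close>, and \<open>g\<close> supplies
    \<open>form H\<close>.\<close>
  proof (rule prod_primes_dvd[OF finite prime_form form_not_dvd_cofactor])
    fix H assume H: "H \<in> A"
    have "form H * cofactor H dvd g * cofactor H"
      using form_dvd_low_degree[OF D g deg H] by (intro mult_dvd_mono) auto
    then show "(\<Prod>H\<in>A. form H) dvd cofactor H * g"
      using defpoly_eq[OF H] by (simp add: defpoly_def mult.commute)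
  qed
  then show ?thesis
    using homogeneous_dvd_low_degree_eq_0[OF defpoly_graded_piece deg(1)] deg(2)
    by (simp add: defpoly_def)
qed

lemma partial_deriv_defpoly_nonzero: "\<exists>i. partial_deriv i defpoly \<noteq> 0"
proof -
  obtain H where "H \<in> A" using nonempty by blast
  then obtain i where "\<not> form H dvd partial_deriv i defpoly"
    using exists_partial_deriv_not_dvd by blast
  then have "partial_deriv i defpoly \<noteq> 0" by auto
  then show ?thesis ..
qed

end


section \<open>Minimal generators of lowest degree\<close>

lemma mpoly_space_span_subset_ideal:
  "mpoly_space.span X \<subseteq> ring_self.span X"
proof (rule mpoly_space.span_minimal)
  show "X \<subseteq> ring_self.span X" by (rule ring_self.span_superset)
  show "mpoly_space.subspace (ring_self.span X)"
    by (rule mpoly_space.subspaceI)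
      (auto intro: ring_self.span_zero ring_self.span_add ring_self.span_scale)
qed

text \<open>A linear dependence writes one generator as a combination of the others with constant
  coefficients, so it is redundant for the ideal as well.\<close>

lemma minimal_generators_independent:
  assumes "minimal_generators G I"
  shows "mpoly_space.independent G"
proof
  assume "mpoly_space.dependent G"
  then obtain g where g: "g \<in> G" "g \<in> mpoly_space.span (G - {g})"
    by (auto simp: mpoly_space.dependent_def)
  then have "g \<in> ring_self.span (G - {g})"
    using mpoly_space_span_subset_ideal by blast
  then have "G \<subseteq> ring_self.span (G - {g})"
    using ring_self.span_superset[of "G - {g}"] by blast
  then have "ring_self.span G \<subseteq> ring_self.span (G - {g})"
    by (rule ring_self.span_minimal[OF _ ring_self.subspace_span])
  moreover have "ring_self.span (G - {g}) \<subseteq> ring_self.span G" by (rule ring_self.span_mono) blast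
  ultimately have "ring_self.span (G - {g}) = I"
    using assms by (simp add: minimal_generators_def)
  moreover have "G - {g} \<subset> G" using g(1) by blast
  ultimately show False using assms by (auto simp: minimal_generators_def)
qed

text \<open>A form of degree \<open>d\<close> has all exponents at most \<open>d\<close>, so it lies
  in the span of finitely many monomials. Finiteness matters because \<open>card\<close> of an
  infinite set is 0.\<close>

lemma finite_independent_graded_piece:
  fixes G :: "('v::finite, 'k::field) mpoly set"
  assumes "mpoly_space.independent G" "G \<subseteq> graded_piece d"
  shows "finite G"
proof -
  define box where "box = {m :: 'v \<Rightarrow>\<^sub>0 nat. keys m \<subseteq> UNIV \<and> (\<forall>i. lookup m i < Suc d)}"
  have box: "finite box"
    unfolding box_def using card_monomial_box(1)[of "Suc d" UNIV] by simp
  have "g \<in> mpoly_space.span ((\<lambda>m. single m 1) ` box)" if "g \<in> G" for g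
  proof (rule mpoly_in_span_monomials, rule subsetI)
    fix m assume "m \<in> keys g"
    then have "monomial_degree m = d" using assms(2) that by (auto simp: graded_piece_iff)
    moreover have "lookup m i \<le> monomial_degree m" for i
      unfolding monomial_degree_def by (rule member_le_sum) auto
    ultimately show "m \<in> box" by (simp add: box_def less_Suc_eq_le)
  qed
  then have "G \<subseteq> mpoly_space.span ((\<lambda>m. single m 1) ` box)" by blast
  then show ?thesis
    using mpoly_space.independent_span_bound[OF finite_imageI[OF box] assms(1)] by blast
qed

lemma mpoly_diff_constant_order_ge: "p - pconst (lookup p 0) \<in> order_ge 1"
proof -
  have "m \<noteq> 0" if "m \<in> keys (p - pconst (lookup p 0))" for m
    using that by (auto simp: in_keys_iff lookup_minus)
  then have "0 < monomial_degree m" if "m \<in> keys (p - pconst (lookup p 0))" for m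
    using that by (metis gr0I monomial_degree_eq_0_iff)
  then show ?thesis by (simp add: order_ge_def Suc_le_eq)
qed

text \<open>Modulo terms of degree above \<open>e\<close>, multiplying a form of degree
  \<open>e\<close> by \<open>c\<close> only multiplies it by the constant term of \<open>c\<close>.
  Ideal combinations thus become linear ones in the lowest degree.\<close>

lemma lowest_degree_in_span:
  fixes T :: "('v::finite, 'k::field) mpoly set"
  assumes homogeneous: "T \<subseteq> (\<Union>d. graded_piece d)"
    and low: "\<And>t d. t \<in> T \<Longrightarrow> t \<in> graded_piece d \<Longrightarrow> d < e \<Longrightarrow> t = 0"
    and h: "h \<in> ring_self.span T" "h \<in> graded_piece e"
  shows "h \<in> mpoly_space.span (T \<inter> graded_piece e)"
proof -
  let ?W = "mpoly_space.span (T \<inter> graded_piece e)"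
  \<comment> \<open>The polynomials congruent, modulo degree above \<open>e\<close>, to a linear
    combination of the degree \<open>e\<close> elements of \<open>T\<close>. They form an ideal
    containing \<open>T\<close>.\<close>
  define U where "U = {h. \<exists>w\<in>?W. h - w \<in> order_ge (Suc e)}"
  have W_graded: "?W \<subseteq> graded_piece e"
  proof (rule mpoly_space.span_minimal)
    show "mpoly_space.subspace (graded_piece e)"
      using graded_piece_mult[OF graded_piece_pconst, of _ e]
      by (intro mpoly_space.subspaceI) (simp_all add: graded_piece_add)
  qed simp
  have U_I: "h \<in> U" if "w \<in> ?W" "h - w \<in> order_ge (Suc e)" for h w
    using that by (auto simp: U_def)
  have zero_W: "0 \<in> ?W" by (rule mpoly_space.span_zero)
  have "ring_self.subspace U"
  proof (rule ring_self.subspaceI)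
    show "0 \<in> U" using zero_W by (intro U_I[of 0]) simp_all
  next
    fix x y assume "x \<in> U" "y \<in> U"
    then obtain w w' where w: "w \<in> ?W" "w' \<in> ?W"
      "x - w \<in> order_ge (Suc e)" "y - w' \<in> order_ge (Suc e)" by (auto simp: U_def)
    have "(x - w) + (y - w') \<in> order_ge (Suc e)" using w(3,4) by (rule order_ge_add)
    then have "(x + y) - (w + w') \<in> order_ge (Suc e)" by (simp add: algebra_simps)
    moreover have "w + w' \<in> ?W" using w(1,2) by (rule mpoly_space.span_add)
    ultimately show "x + y \<in> U" by (intro U_I)
  next
    fix c x assume "x \<in> U"
    then obtain w where w: "w \<in> ?W" "x - w \<in> order_ge (Suc e)" by (auto simp: U_def)
    \<comment> \<open>With \<open>c0\<close> the constant term of \<open>c\<close>,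
      \<open>c * x - c0 * w\<close> is the sum of \<open>c * (x - w)\<close> and
      \<open>(c - c0) * w\<close>, and both have order above \<open>e\<close>.\<close>
    have "c * (x - w) \<in> order_ge (0 + Suc e)"
      by (rule order_ge_mult[OF order_ge_0 w(2)])
    moreover have "w \<in> order_ge e" using W_graded w(1) graded_piece_order_ge by blast
    then have "(c - pconst (lookup c 0)) * w \<in> order_ge (1 + e)"
      by (rule order_ge_mult[OF mpoly_diff_constant_order_ge])
    ultimately have "c * (x - w) + (c - pconst (lookup c 0)) * w \<in> order_ge (Suc e)"
      by (intro order_ge_add) simp_all
    moreover have "c * (x - w) + (c - pconst (lookup c 0)) * w = c * x - pconst (lookup c 0) * w"
      by (simp add: right_diff_distrib left_diff_distrib)
    moreover have "pconst (lookup c 0) * w \<in> ?W" using w(1) by (rule mpoly_space.span_scale)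
    ultimately show "c * x \<in> U" by (intro U_I[of "pconst (lookup c 0) * w"]) simp_all
  qed
  moreover have "T \<subseteq> U"
  proof
    fix t assume t: "t \<in> T"
    then obtain d where d: "t \<in> graded_piece d" using homogeneous by blast
    consider "d < e" | "d = e" | "e < d" by linarith
    then show "t \<in> U"
    proof cases
      case 1
      then have "t = 0" using low t d by blast
      then show ?thesis using zero_W by (intro U_I[of 0]) simp_all
    next
      case 2
      then have "t \<in> ?W" using t d by (intro mpoly_space.span_base) simp
      then show ?thesis by (intro U_I[of t]) simp_all
    next
      case 3
      then have "t \<in> order_ge (Suc e)" using graded_piece_order_ge[OF d] by simp
      then show ?thesis using zero_W by (intro U_I[of 0]) simp_all
    qed
  qed
  ultimately have "ring_self.span T \<subseteq> U" by (rule ring_self.span_minimal[rotated])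
  then obtain w where w: "w \<in> ?W" "h - w \<in> order_ge (Suc e)" using h(1) by (auto simp: U_def)
  have "h - w \<in> graded_piece e"
    using h(2) W_graded w(1) by (blast intro: graded_piece_diff)
  then have "h - w = 0" using w(2) by (rule graded_piece_order_ge_eq_0) simp
  then show ?thesis using w(1) by simp
qed

text \<open>By Steinitz exchange, an independent set in the span of a finite set is no larger than
  that set.\<close>

lemma card_lowest_degree_generators_mono:
  fixes I J :: "('v::finite, 'k::field) mpoly set"
  assumes "I \<subseteq> J" and low: "\<And>h d. h \<in> J \<Longrightarrow> h \<in> graded_piece d \<Longrightarrow> d < e \<Longrightarrow> h = 0"
    and G: "minimal_generators G I" and T: "minimal_generators T J"
  shows "card (G \<inter> graded_piece e) \<le> card (T \<inter> graded_piece e)"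
proof -
  have spans: "ring_self.span G = I" "ring_self.span T = J"
    and homogeneous: "T \<subseteq> (\<Union>d. graded_piece d)"
    using G T by (simp_all add: minimal_generators_def)
  have "T \<subseteq> J" using spans(2) ring_self.span_superset by blast
  have "G \<subseteq> J" using spans(1) ring_self.span_superset assms(1) by blast
  have "h \<in> mpoly_space.span (T \<inter> graded_piece e)" if "h \<in> G \<inter> graded_piece e" for h
    using homogeneous
  proof (rule lowest_degree_in_span)
    show "t = 0" if "t \<in> T" "t \<in> graded_piece d" "d < e" for t d
      using low that \<open>T \<subseteq> J\<close> by blast
  qed (use that \<open>G \<subseteq> J\<close> spans in auto)
  then have "G \<inter> graded_piece e \<subseteq> mpoly_space.span (T \<inter> graded_piece e)" by blast
  moreover have indep: "mpoly_space.independent (X \<inter> graded_piece e)"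
    if "minimal_generators X Y" for X Y
    using mpoly_space.independent_mono[OF minimal_generators_independent[OF that]] by simp
  moreover have "finite (T \<inter> graded_piece e)"
    by (rule finite_independent_graded_piece[OF indep[OF T]]) blast
  ultimately show ?thesis
    using mpoly_space.independent_span_bound[OF _ indep[OF G]] by blast
qed

theorem theorem5p2:
  fixes n :: nat
    and A :: "('k::field_char_0 ^ 'v::finite) set set"
    and f :: "('v, 'k) mpoly"
    and D :: "('v, 'k) mpoly set set"
  assumes "2 \<le> n" and "CARD('v) = n + 1"
    and "hyperplane_arrangement A"
    and "defining_polynomial A f"
    and "primary_decomposition D (Jac f)"
  shows "initial_degree (height_two_part D) = enat (card A - 1) \<and>
    (\<forall>G T. minimal_generators G (Jac f) \<and> minimal_generators T (height_two_part D) \<longrightarrow>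
       card (G \<inter> graded_piece (card A - 1)) \<le> card (T \<inter> graded_piece (card A - 1)))"
proof -
  obtain a where a: "\<forall>H\<in>A. a H \<noteq> 0 \<and> H = hyperplane_of (a H)"
    and f: "f = (\<Prod>H\<in>A. linear_form (a H))"
    using assms(4) by (auto simp: defining_polynomial_def)
  interpret arrangement_forms A a
    using assms(3) a by unfold_locales (auto simp: hyperplane_arrangement_def)
  have f: "f = defpoly" by (simp add: f defpoly_def)
  let ?J = "height_two_part D"
  have D: "primary_decomposition D (Jac defpoly)" using assms(5) f by simp
  \<comment> \<open>Intersecting only some of the components gives a larger ideal.\<close>
  have Jac_sub: "Jac f \<subseteq> ?J"
    using D by (auto simp: f primary_decomposition_def height_two_part_def)
  have low: "h = 0" if "h \<in> ?J" "h \<in> graded_piece d" "d < card A - 1" for h d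
    using D that by (rule height_two_part_low_degree)
  \<comment> \<open>\<open>initial_degree\<close> compares each graded component with
    \<open>{0}\<close>, so an empty intersection has to be excluded.\<close>
  have zero: "0 \<in> ?J" using Jac_sub ring_self.span_zero by (auto simp: Jac_def)
  have "initial_degree ?J = enat (card A - 1)"
    unfolding initial_degree_def
  proof (rule antisym)
    obtain i where "partial_deriv i defpoly \<noteq> 0" using partial_deriv_defpoly_nonzero by blast
    moreover have "partial_deriv i defpoly \<in> ?J \<inter> graded_piece (card A - 1)"
      using Jac_sub partial_deriv_in_Jac partial_deriv_defpoly_graded_piece f by blast
    ultimately have "?J \<inter> graded_piece (card A - 1) \<noteq> {0}" by blast
    then show "Inf {enat j |j. ?J \<inter> graded_piece j \<noteq> {0}} \<le> enat (card A - 1)"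
      by (intro Inf_lower) blast
  next
    have "card A - 1 \<le> j" if "?J \<inter> graded_piece j \<noteq> {0}" for j
    proof (rule ccontr)
      assume "\<not> card A - 1 \<le> j"
      then have "?J \<inter> graded_piece j \<subseteq> {0}" using low by auto
      then show False using that zero by auto
    qed
    then show "enat (card A - 1) \<le> Inf {enat j |j. ?J \<inter> graded_piece j \<noteq> {0}}"
      by (intro Inf_greatest) fastforce
  qed
  moreover have "card (G \<inter> graded_piece (card A - 1)) \<le> card (T \<inter> graded_piece (card A - 1))"
    if "minimal_generators G (Jac f)" "minimal_generators T ?J" for G T
    using Jac_sub _ that by (rule card_lowest_degree_generators_mono) (rule low)
  ultimately show ?thesis by blast
qed

end
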